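(* Let $G=(V,E)$ be a locally finite simple graph and $x\in V$. If the punctured $2$-ball $\mathring B_2(x)$ has more than one connected component, then $\mathcal K_{G,x}(\infty)<0$, except when the $2$-ball $B_2(x)$ is one of the following five, in which $\mathcal K_{G,x}(\infty)\ge0$: (a) $d_x=2$, the two neighbours of $x$ are not adjacent, and $S_2(x)=\emptyset$ (so $B_2(x)$ is a path with $3$ vertices and midpoint $x$); (b) $d_x=2$, the two neighbours of $x$ are not adjacent, one of them has no neighbour in $S_2(x)$ and the other has exactly one (so $B_2(x)$ is a path with $4$ vertices, $x$ being an inner vertex); (c) $d_x=2$, the two neighbours of $x$ are not adjacent, each has exactly one neighbour in $S_2(x)$, and these two vertices of $S_2(x)$ are distinct (so $B_2(x)$ is a path with $5$ vertices and midpoint $x$); (d) $d_x=3$, no two neighbours of $x$ are adjacent, and $S_2(x)=\emptyset$ (so $B_2(x)=K_{1,3}$ with centre $x$); (e) $d_x=3$, exactly one pair of neighbours of $x$ is adjacent, and $S_2(x)=\emptyset$ (so $B_2(x)$ is a triangle containing $x$ with one pendant edge attached at $x$).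
   Context: Graphs are undirected, without loops or multiple edges, and every vertex has finite degree; $d_x$ is the degree of $x$. For $f:V\to\mathbb R$ put $\Delta f(x)=\sum_{y\sim x}(f(y)-f(x))$ (non-normalized Laplacian), and for $f,g:V\to\mathbb R$ put $2\Gamma(f,g)=\Delta(fg)-f\Delta g-g\Delta f$, $2\Gamma_2(f,g)=\Delta\Gamma(f,g)-\Gamma(f,\Delta g)-\Gamma(\Delta f,g)$, $\Gamma(f)=\Gamma(f,f)$, $\Gamma_2(f)=\Gamma_2(f,f)$. $\mathcal K_{G,x}(\infty)$ is the largest $K\in\mathbb R$ such that $\Gamma_2(f)(x)\ge K\,\Gamma(f)(x)$ for all $f:V\to\mathbb R$. $S_r(x)$ is the set of vertices at graph distance $r$ from $x$. $B_2(x)$ denotes the graph with vertex set $\{x\}\cup S_1(x)\cup S_2(x)$ whose edges are the edges of $G$ between $x$ and $S_1(x)$, between two vertices of $S_1(x)$, and between $S_1(x)$ and $S_2(x)$ (edges between two vertices of $S_2(x)$ are not included). $\mathring B_2(x)$ is obtained from $B_2(x)$ by deleting $x$ and all edges between $x$ and $S_1(x)$. *)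

theory Defs
  imports Complex_Main "Graph_Theory.Graph_Theory"
begin

text \<open>
  An undirected simple graph is a symmetric loop-free digraph without parallel arcs: each edge is
  represented by its two arcs, so \<^const>\<open>out_degree\<close> is the usual degree and
  the strongly connected components are the usual connected components.
\<close>

locale locally_finite_graph = pair_bidirected_digraph +
  assumes locally_finite: "v \<in> pverts G \<Longrightarrow> finite (out_arcs (with_proj G) v)"

definition neighbours :: "'a pair_pre_digraph \<Rightarrow> 'a \<Rightarrow> 'a set" where
  "neighbours G v = {w. (v, w) \<in> parcs G}"

definition degree :: "'a pair_pre_digraph \<Rightarrow> 'a \<Rightarrow> nat" where
  "degree G v = out_degree (with_proj G) v"

text \<open>
  Functions on the vertex set are represented by total functions on the ambient type. Their values
  outside \<^term>\<open>pverts G\<close> do not affect the operators below at vertices of a well-formed \<^term>\<open>G\<close>.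
\<close>

definition laplacian :: "'a pair_pre_digraph \<Rightarrow> ('a \<Rightarrow> real) \<Rightarrow> 'a \<Rightarrow> real" where
  "laplacian G f v = (\<Sum>w\<in>neighbours G v. f w - f v)"

definition Gam :: "'a pair_pre_digraph \<Rightarrow> ('a \<Rightarrow> real) \<Rightarrow> ('a \<Rightarrow> real) \<Rightarrow> 'a \<Rightarrow> real" where
  "Gam G f g v =
    (laplacian G (\<lambda>w. f w * g w) v - f v * laplacian G g v - g v * laplacian G f v) / 2"

definition Gam2 :: "'a pair_pre_digraph \<Rightarrow> ('a \<Rightarrow> real) \<Rightarrow> ('a \<Rightarrow> real) \<Rightarrow> 'a \<Rightarrow> real" where
  "Gam2 G f g v =
    (laplacian G (Gam G f g) v - Gam G f (laplacian G g) v - Gam G (laplacian G f) g v) / 2"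

text \<open>
  The Bakry-Emery curvature with dimension parameter infinity. At an isolated vertex every
  \<open>K\<close> satisfies the inequality, so there is no largest one and the value is unspecified.
\<close>

definition curvature_inf :: "'a pair_pre_digraph \<Rightarrow> 'a \<Rightarrow> real" where
  "curvature_inf G x = (GREATEST K. \<forall>f. Gam2 G f f x \<ge> K * Gam G f f x)"

text \<open>With unit weights, \<^const>\<open>wf_digraph.\<mu>\<close> is the graph distance.\<close>

definition vsphere :: "'a pair_pre_digraph \<Rightarrow> nat \<Rightarrow> 'a \<Rightarrow> 'a set" where
  "vsphere G r x = {y \<in> pverts G. wf_digraph.\<mu> (with_proj G) (\<lambda>_. 1) x y = ereal (real r)}"

definition ball2 :: "'a pair_pre_digraph \<Rightarrow> 'a \<Rightarrow> 'a pair_pre_digraph" where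
  "ball2 G x = (let S1 = vsphere G 1 x; S2 = vsphere G 2 x in
    \<lparr> pverts = {x} \<union> S1 \<union> S2,
      parcs = parcs G \<inter>
        ({x} \<times> S1 \<union> S1 \<times> {x} \<union> S1 \<times> S1 \<union> S1 \<times> S2 \<union> S2 \<times> S1) \<rparr>)"

definition punctured_ball2 :: "'a pair_pre_digraph \<Rightarrow> 'a \<Rightarrow> ('a, 'a \<times> 'a) pre_digraph" where
  "punctured_ball2 G x = pre_digraph.del_vert (with_proj (ball2 G x)) x"

definition adjacent_pairs :: "'a pair_pre_digraph \<Rightarrow> 'a \<Rightarrow> 'a set set" where
  "adjacent_pairs G x = {{y, z} | y z. y \<in> vsphere G 1 x \<and> z \<in> vsphere G 1 x \<and> (y, z) \<in> parcs G}"

text \<open>The path with three vertices and midpoint \<^term>\<open>x\<close>.\<close>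

definition ball2_P3 :: "'a pair_pre_digraph \<Rightarrow> 'a \<Rightarrow> bool" where
  "ball2_P3 G x \<longleftrightarrow> degree G x = 2 \<and> adjacent_pairs G x = {} \<and> vsphere G 2 x = {}"

text \<open>The path with four vertices and inner vertex \<^term>\<open>x\<close>.\<close>

definition ball2_P4 :: "'a pair_pre_digraph \<Rightarrow> 'a \<Rightarrow> bool" where
  "ball2_P4 G x \<longleftrightarrow> degree G x = 2 \<and> adjacent_pairs G x = {} \<and>
    (\<exists>y z. y \<noteq> z \<and> vsphere G 1 x = {y, z} \<and>
      neighbours G y \<inter> vsphere G 2 x = {} \<and> card (neighbours G z \<inter> vsphere G 2 x) = 1)"

text \<open>The path with five vertices and midpoint \<^term>\<open>x\<close>.\<close>

definition ball2_P5 :: "'a pair_pre_digraph \<Rightarrow> 'a \<Rightarrow> bool" where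
  "ball2_P5 G x \<longleftrightarrow> degree G x = 2 \<and> adjacent_pairs G x = {} \<and>
    (\<exists>y z u v. y \<noteq> z \<and> vsphere G 1 x = {y, z} \<and> u \<noteq> v \<and>
      neighbours G y \<inter> vsphere G 2 x = {u} \<and> neighbours G z \<inter> vsphere G 2 x = {v})"

text \<open>The star with three leaves and centre \<^term>\<open>x\<close>.\<close>

definition ball2_K13 :: "'a pair_pre_digraph \<Rightarrow> 'a \<Rightarrow> bool" where
  "ball2_K13 G x \<longleftrightarrow> degree G x = 3 \<and> adjacent_pairs G x = {} \<and> vsphere G 2 x = {}"

text \<open>A triangle containing \<^term>\<open>x\<close>, with one pendant edge attached at \<^term>\<open>x\<close>.\<close>

definition ball2_paw :: "'a pair_pre_digraph \<Rightarrow> 'a \<Rightarrow> bool" where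
  "ball2_paw G x \<longleftrightarrow> degree G x = 3 \<and> card (adjacent_pairs G x) = 1 \<and> vsphere G 2 x = {}"

definition exceptional_ball2 :: "'a pair_pre_digraph \<Rightarrow> 'a \<Rightarrow> bool" where
  "exceptional_ball2 G x \<longleftrightarrow>
    ball2_P3 G x \<or> ball2_P4 G x \<or> ball2_P5 G x \<or> ball2_K13 G x \<or> ball2_paw G x"

end

theory Submission
  imports Defs
begin

text \<open>
  Normalise \<open>f x = 0\<close>. Then \<open>4 \<Gamma>\<^sub>2(f)(x)\<close> is
  \<open>(3 - d) \<Sum> f(y)\<^sup>2 + 2 (\<Sum> f(y))\<^sup>2\<close>, summed over the \<open>d\<close> neighbours \<open>y\<close> of \<open>x\<close>, plus a
  contribution of each edge from \<open>S\<^sub>1\<close> to \<open>S\<^sub>1\<close> or \<open>S\<^sub>2\<close>. An edge inside \<open>S\<^sub>1\<close> contributes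
  \<open>4 (f(y) - f(z))\<^sup>2\<close>, and an edge from \<open>y\<close> to \<open>S\<^sub>2\<close> contributes at least \<open>- f(y)\<^sup>2\<close>. So the form is
  nonnegative as soon as \<open>d\<close> plus the number of neighbours of \<open>y\<close> in \<open>S\<^sub>2\<close> is at most 3 for every
  \<open>y\<close>, which covers the five exceptional balls. If the punctured ball splits into two parts
  containing \<open>m\<close> and \<open>n\<close> neighbours of \<open>x\<close>, take \<open>f = a\<close> and \<open>f = b\<close> on these neighbours and \<open>2 a\<close>
  and \<open>2 b\<close> on \<open>S\<^sub>2\<close>: the edges inside \<open>S\<^sub>1\<close> drop out and each edge to \<open>S\<^sub>2\<close> attains its lower bound.
  The choice \<open>(a, b) = (n, -m)\<close> is negative for \<open>d \<ge> 4\<close> and for \<open>d = 3\<close>, \<open>S\<^sub>2 \<noteq> {}\<close>; for \<open>d = 2\<close>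
  the choice \<open>(1, -2/3)\<close> is negative when the first neighbour has at least two neighbours
  in \<open>S\<^sub>2\<close>.
\<close>

section \<open>The contribution of a two-step walk\<close>

text \<open>With \<open>a = f y - f x\<close> and \<open>b = f z - f x\<close>, this is
  \<open>(f z - f y)^2 - 2 * (f y - f x) * (f z - f y)\<close>, the contribution to
  \<open>4 * Gam2\<close> of the walk from \<open>x\<close> over \<open>y\<close> to
  \<open>z\<close>. The square is completed in \<open>b\<close>, so that the minimum
  \<open>- a^2\<close>, attained at \<open>b = 2 * a\<close>, can be read off.\<close>

definition gamma2_kernel :: "real \<Rightarrow> real \<Rightarrow> real" where
  "gamma2_kernel a b = (b - 2 * a)\<^sup>2 - a\<^sup>2"

lemma gamma2_kernel_ge: "gamma2_kernel a b \<ge> - a\<^sup>2"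
  by (simp add: gamma2_kernel_def)

lemma gamma2_kernel_0: "gamma2_kernel a 0 = 3 * a\<^sup>2"
  by (simp add: gamma2_kernel_def power_mult_distrib)

text \<open>\<open>C\<close> is the set of vertices reachable from a vertex \<open>u\<close> of one
  component. Reachability is symmetric here, so a vertex \<open>v\<close> of another component stays
  outside \<open>C\<close>, and no arc crosses the boundary of \<open>C\<close> in either
  direction.\<close>

lemma (in sym_digraph) sccs_disconnectedE:
  assumes "card sccs > 1"
  obtains C u v where "u \<in> verts G" "v \<in> verts G" "u \<in> C" "v \<notin> C"
    "\<And>p q. p \<rightarrow> q \<Longrightarrow> p \<in> C \<longleftrightarrow> q \<in> C"
proof -
  from assms have c: "card sccs_verts > 1" by (simp add: card_sccs_verts)
  then obtain S T where ST: "S \<in> sccs_verts" "T \<in> sccs_verts" "S \<noteq> T"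
    by (metis card_le_Suc0_iff_eq card.infinite leD One_nat_def not_less_zero)
  then have dis: "S \<inter> T = {}" by (rule sccs_verts_disjoint)
  obtain u v where u: "u \<in> S" and v: "v \<in> T"
    using ST unfolding in_sccs_verts_conv_reachable by blast
  with dis have "v \<notin> S" by blast
  with u ST(1) have "\<not> (u \<rightarrow>\<^sup>* v \<and> v \<rightarrow>\<^sup>* u)"
    unfolding in_sccs_verts_conv_reachable by blast
  then have nr: "\<not> u \<rightarrow>\<^sup>* v"
    using symmetric_reachable[OF sym_arcs] by blast
  show ?thesis
  proof (rule that[of u v "{w. u \<rightarrow>\<^sup>* w}"])
    show "u \<in> verts G" using sccs_verts_subsets[OF ST(1)] u by blast
    then show "u \<in> {w. u \<rightarrow>\<^sup>* w}" by simp
    show "v \<in> verts G" using sccs_verts_subsets[OF ST(2)] v by blast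
    show "v \<notin> {w. u \<rightarrow>\<^sup>* w}" using nr by simp
    fix p q assume pq: "p \<rightarrow> q"
    then have "q \<rightarrow> p" using sym_arcs by (auto simp: symmetric_def elim: symE)
    with pq show "p \<in> {w. u \<rightarrow>\<^sup>* w} \<longleftrightarrow> q \<in> {w. u \<rightarrow>\<^sup>* w}"
      by (auto intro: reachable_adj_trans)
  qed
qed

context locally_finite_graph
begin

section \<open>Neighbourhoods, walks and spheres\<close>

lemma neighbours_sym: "w \<in> neighbours G v \<longleftrightarrow> v \<in> neighbours G w"
  by (auto simp: neighbours_def intro: arcs_symmetric)

lemma not_in_neighbours: "v \<notin> neighbours G v"
  using pair_no_loops[of "(v, v)"] by (auto simp: neighbours_def)

lemma out_arcs_eq: "out_arcs (with_proj G) v = Pair v ` neighbours G v"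
  by (auto simp: neighbours_def)

lemma finite_neighbours: "finite (neighbours G v)"
proof (cases "v \<in> pverts G")
  case True
  from locally_finite[OF this] show ?thesis
    unfolding out_arcs_eq by (rule finite_imageD) (simp add: inj_on_def)
next
  case False
  then have "neighbours G v = {}" by (auto simp: neighbours_def dest: in_arcsD1)
  then show ?thesis by simp
qed

lemma degree_eq_card: "degree G v = card (neighbours G v)"
  by (simp add: degree_def out_degree_def out_arcs_eq card_image inj_on_def)

text \<open>With unit weights the cost of a walk is its length, a natural number, so the infimum
  defining the distance is attained by a shortest walk. Without any walk the infimum is infinite and
  equals no real number.\<close>

lemma mu_eq_iff:
  "\<mu> (\<lambda>_. 1) u v = ereal (real n) \<longleftrightarrow>
    (\<exists>p. awalk u p v \<and> length p = n) \<and> (\<forall>p. awalk u p v \<longrightarrow> n \<le> length p)"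
proof (cases "\<exists>p. awalk u p v")
  case False
  then have "{p. awalk u p v} = {}" by blast
  then have "\<mu> (\<lambda>_. 1) u v = top" unfolding \<mu>_def by (simp only: image_empty Inf_empty)
  with False show ?thesis by (auto simp: top_ereal_def)
next
  case True
  have cost: "awalk_cost (\<lambda>_. 1) p = real (length p)" for p :: "('a \<times> 'a) list"
    by (induction p) auto
  define q where "q = (ARG_MIN length p. awalk u p v)"
  have q: "awalk u q v" "\<And>p. awalk u p v \<Longrightarrow> length q \<le> length p"
    using True arg_min_natI[of "\<lambda>p. awalk u p v"] arg_min_nat_le[of "\<lambda>p. awalk u p v"]
    unfolding q_def by blast+
  have "\<mu> (\<lambda>_. 1) u v = ereal (real (length q))"
    unfolding \<mu>_def cost
    by (rule antisym[OF INF_lower INF_greatest]) (use q in auto)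
  with q show ?thesis by (auto intro: antisym)
qed

lemma vsphere_1:
  assumes "x \<in> pverts G"
  shows "vsphere G 1 x = neighbours G x"
proof (intro set_eqI iffI)
  fix y assume "y \<in> vsphere G 1 x"
  then have "\<mu> (\<lambda>_. 1) x y = ereal (real 1)" by (simp add: vsphere_def)
  then obtain p where "awalk x p y" "length p = 1"
    unfolding mu_eq_iff by blast
  then show "y \<in> neighbours G x"
    by (auto simp: length_Suc_conv neighbours_def awalk_simps)
next
  fix y assume "y \<in> neighbours G x"
  then have e: "(x, y) \<in> parcs G" by (simp add: neighbours_def)
  then have "awalk x [(x, y)] y" "x \<noteq> y" "y \<in> pverts G"
    using assms pair_no_loops[OF e] by (auto simp: awalk_simps dest: in_arcsD2)
  moreover have "1 \<le> length p" if "awalk x p y" for p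
    using that \<open>x \<noteq> y\<close> by (cases p) (auto simp: awalk_simps)
  ultimately have "\<mu> (\<lambda>_. 1) x y = ereal (real 1)"
    unfolding mu_eq_iff by (metis One_nat_def length_Cons list.size(3))
  with \<open>y \<in> pverts G\<close> show "y \<in> vsphere G 1 x" by (simp add: vsphere_def)
qed

lemma vsphere_2:
  assumes "x \<in> pverts G"
  shows "vsphere G 2 x = (\<Union>y\<in>neighbours G x. neighbours G y) - insert x (neighbours G x)"
proof (intro set_eqI iffI)
  fix z assume z: "z \<in> vsphere G 2 x"
  then have "\<mu> (\<lambda>_. 1) x z = ereal (real 2)" by (simp add: vsphere_def)
  then obtain p where "awalk x p z" "length p = 2" and
    min: "\<And>p. awalk x p z \<Longrightarrow> 2 \<le> length p"
    unfolding mu_eq_iff by blast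
  then have "z \<in> (\<Union>y\<in>neighbours G x. neighbours G y)"
    by (auto simp: length_Suc_conv numeral_2_eq_2 neighbours_def awalk_simps)
  moreover have "z \<noteq> x" using min[of "[]"] assms by (auto simp: awalk_simps)
  moreover have "z \<notin> neighbours G x"
    using min[of "[(x, z)]"] by (auto simp: awalk_simps neighbours_def dest: in_arcsD2)
  ultimately show "z \<in> (\<Union>y\<in>neighbours G x. neighbours G y) - insert x (neighbours G x)"
    by blast
next
  fix z assume z: "z \<in> (\<Union>y\<in>neighbours G x. neighbours G y) - insert x (neighbours G x)"
  then obtain y where e: "(x, y) \<in> parcs G" "(y, z) \<in> parcs G"
    by (auto simp: neighbours_def)
  then have "awalk x [(x, y), (y, z)] z" "z \<in> pverts G"
    using assms by (auto simp: awalk_simps dest: in_arcsD2)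
  moreover have "2 \<le> length p" if "awalk x p z" for p
  proof (rule ccontr)
    assume "\<not> 2 \<le> length p"
    then consider "p = []" | e where "p = [e]"
      by (cases p; cases "tl p") auto
    then show False
      using that z by cases (auto simp: awalk_simps neighbours_def)
  qed
  ultimately have "\<mu> (\<lambda>_. 1) x z = ereal (real 2)"
    unfolding mu_eq_iff by (metis numeral_2_eq_2 length_Cons list.size(3))
  with \<open>z \<in> pverts G\<close> show "z \<in> vsphere G 2 x" by (simp add: vsphere_def)
qed

section \<open>Explicit formulas for the two forms\<close>

lemma Gam_eq: "Gam G f g v = (\<Sum>w\<in>neighbours G v. (f w - f v) * (g w - g v)) / 2"
  unfolding Gam_def laplacian_def sum_distrib_left sum_subtractf[symmetric]
  by (simp add: algebra_simps)

text \<open>The factor 4 clears the halves in \<open>Gam\<close> and \<open>Gam2\<close>. Collecting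
  terms by two-step walks from \<open>x\<close> gives one kernel value for each walk, including
  those that return with \<open>z = x\<close>.\<close>

lemma Gam2_eq:
  "4 * Gam2 G f f x =
    (\<Sum>y\<in>neighbours G x. \<Sum>z\<in>neighbours G y. gamma2_kernel (f y - f x) (f z - f x))
    - real (degree G x) * (\<Sum>y\<in>neighbours G x. (f y - f x)\<^sup>2)
    + 2 * (\<Sum>y\<in>neighbours G x. f y - f x)\<^sup>2"
proof -
  let ?N = "neighbours G"
  have "4 * Gam2 G f f x = 2 * laplacian G (Gam G f f) x - 4 * Gam G f (laplacian G f) x"
    unfolding Gam2_def by (simp add: Gam_eq mult.commute)
  also have "2 * laplacian G (Gam G f f) x =
      (\<Sum>y\<in>?N x. \<Sum>z\<in>?N y. (f z - f y)\<^sup>2) - real (degree G x) * (\<Sum>y\<in>?N x. (f y - f x)\<^sup>2)"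
    unfolding laplacian_def Gam_eq
    by (simp add: sum_subtractf degree_eq_card right_diff_distrib
        flip: sum_divide_distrib power2_eq_square)
  also have "4 * Gam G f (laplacian G f) x =
      2 * (\<Sum>y\<in>?N x. \<Sum>z\<in>?N y. (f y - f x) * (f z - f y)) - 2 * (\<Sum>y\<in>?N x. f y - f x)\<^sup>2"
  proof -
    have distrib: "(\<Sum>y\<in>?N x. g y * (h y - c)) = (\<Sum>y\<in>?N x. g y * h y) - (\<Sum>y\<in>?N x. g y) * c"
      for g h :: "'a \<Rightarrow> real" and c
      by (simp add: right_diff_distrib sum_subtractf sum_distrib_right)
    have "4 * Gam G f (laplacian G f) x =
        2 * (\<Sum>y\<in>?N x. (f y - f x) * (laplacian G f y - laplacian G f x))"
      by (simp add: Gam_eq)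
    also have "\<dots> = 2 * (\<Sum>y\<in>?N x. (f y - f x) * laplacian G f y)
        - 2 * ((\<Sum>y\<in>?N x. f y - f x) * laplacian G f x)"
      unfolding distrib by (rule right_diff_distrib)
    finally show ?thesis
      unfolding laplacian_def sum_distrib_left power2_eq_square by (simp only: mult.assoc)
  qed
  finally have "4 * Gam2 G f f x =
      ((\<Sum>y\<in>?N x. \<Sum>z\<in>?N y. (f z - f y)\<^sup>2)
        - 2 * (\<Sum>y\<in>?N x. \<Sum>z\<in>?N y. (f y - f x) * (f z - f y)))
      - real (degree G x) * (\<Sum>y\<in>?N x. (f y - f x)\<^sup>2) + 2 * (\<Sum>y\<in>?N x. f y - f x)\<^sup>2"
    by simp
  also have "(\<Sum>y\<in>?N x. \<Sum>z\<in>?N y. (f z - f y)\<^sup>2)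
        - 2 * (\<Sum>y\<in>?N x. \<Sum>z\<in>?N y. (f y - f x) * (f z - f y))
      = (\<Sum>y\<in>?N x. \<Sum>z\<in>?N y. gamma2_kernel (f y - f x) (f z - f x))"
    unfolding sum_distrib_left sum_subtractf[symmetric]
    by (intro sum.cong refl) (simp add: gamma2_kernel_def power2_eq_square algebra_simps)
  finally show ?thesis .
qed

section \<open>The curvature is attained\<close>

text \<open>A crude estimate, made only to show that admissible constants exist: every two-step walk
  over \<open>y\<close> costs at most \<open>(f y - f x)^2\<close>, and there are finitely many of
  them.\<close>

lemma Gam2_lower_bound: "\<exists>K. \<forall>f. Gam2 G f f x \<ge> K * Gam G f f x"
proof -
  let ?N = "neighbours G"
  \<comment> \<open>The sum of the degrees of the neighbours serves as a common upper bound for each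
    of them.\<close>
  define M where "M = (\<Sum>y\<in>?N x. card (?N y))"
  have "Gam2 G f f x \<ge> - (real M + real (degree G x)) / 2 * Gam G f f x" for f
  proof -
    let ?s = "\<Sum>y\<in>?N x. (f y - f x)\<^sup>2"
    have "- (real M * ?s) = (\<Sum>y\<in>?N x. - (real M * (f y - f x)\<^sup>2))"
      by (simp add: sum_distrib_left sum_negf)
    also have "\<dots> \<le> (\<Sum>y\<in>?N x. \<Sum>z\<in>?N y. gamma2_kernel (f y - f x) (f z - f x))"
    proof (rule sum_mono)
      fix y assume "y \<in> ?N x"
      then have "card (?N y) \<le> M"
        unfolding M_def by (intro member_le_sum) (auto simp: finite_neighbours)
      then have "- (real M * (f y - f x)\<^sup>2) \<le> (\<Sum>z\<in>?N y. - (f y - f x)\<^sup>2)"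
        by (simp add: mult_right_mono)
      also have "\<dots> \<le> (\<Sum>z\<in>?N y. gamma2_kernel (f y - f x) (f z - f x))"
        by (intro sum_mono gamma2_kernel_ge)
      finally show "- (real M * (f y - f x)\<^sup>2) \<le>
        (\<Sum>z\<in>?N y. gamma2_kernel (f y - f x) (f z - f x))" .
    qed
    finally have "4 * Gam2 G f f x \<ge> - (real M * ?s) - real (degree G x) * ?s"
      unfolding Gam2_eq using zero_le_power2[of "\<Sum>y\<in>?N x. f y - f x"] by linarith
    then show ?thesis unfolding Gam_eq by (simp add: power2_eq_square algebra_simps)
  qed
  then show ?thesis by blast
qed

text \<open>\<open>GREATEST\<close> is informative only once a maximum is known to exist. The
  admissible constants form a nonempty set that is bounded above, and each inequality is closed in
  \<open>K\<close>, so the supremum is itself admissible.\<close>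

lemma curvature_inf_greatest:
  assumes "neighbours G x \<noteq> {}"
  shows "\<And>f. Gam2 G f f x \<ge> curvature_inf G x * Gam G f f x"
    and "\<And>K. (\<And>f. Gam2 G f f x \<ge> K * Gam G f f x) \<Longrightarrow> K \<le> curvature_inf G x"
proof -
  define P where "P K \<longleftrightarrow> (\<forall>f. Gam2 G f f x \<ge> K * Gam G f f x)" for K
  \<comment> \<open>A function with positive \<open>Gam\<close> at \<open>x\<close> turns its own
    inequality into an upper bound for \<open>K\<close>; the existence of a neighbour makes
    \<open>Gam G h h x\<close> positive.\<close>
  define h where "h v = (if v = x then 0 else 1 :: real)" for v
  have "(\<Sum>y\<in>neighbours G x. (h y - h x) * (h y - h x)) = (\<Sum>y\<in>neighbours G x. 1)"
    using not_in_neighbours by (intro sum.cong) (auto simp: h_def)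
  then have pos: "Gam G h h x > 0"
    using assms by (simp add: Gam_eq finite_neighbours card_gt_0_iff)
  have bdd: "K \<le> Gam2 G h h x / Gam G h h x" if "P K" for K
    using that pos by (auto simp: P_def field_simps)
  have bdd_above: "bdd_above (Collect P)"
    using bdd by (intro bdd_aboveI) auto
  have nonempty: "Collect P \<noteq> {}"
    using Gam2_lower_bound by (auto simp: P_def)
  have Sup: "P (Sup (Collect P))"
  proof (rule P_def[THEN iffD2], rule allI)
    fix f
    have nn: "Gam G f f x \<ge> 0" by (simp add: Gam_eq sum_nonneg)
    show "Sup (Collect P) * Gam G f f x \<le> Gam2 G f f x"
    \<comment> \<open>If \<open>Gam\<close> vanishes, the inequality is the same for all constants,
      so any admissible one proves it; otherwise division turns it into an upper bound on the
      constants.\<close>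
    proof (cases "Gam G f f x = 0")
      case True
      moreover obtain K where "P K" using nonempty by blast
      then have "K * Gam G f f x \<le> Gam2 G f f x" by (simp add: P_def)
      ultimately show ?thesis by simp
    next
      case False
      with nn have "Gam G f f x > 0" by simp
      moreover from this have "Sup (Collect P) \<le> Gam2 G f f x / Gam G f f x"
        by (intro cSup_least nonempty) (auto simp: P_def field_simps)
      ultimately show ?thesis by (simp add: field_simps)
    qed
  qed
  have upper: "K \<le> Sup (Collect P)" if "P K" for K
    using that bdd_above by (intro cSup_upper) auto
  have eq: "curvature_inf G x = Sup (Collect P)"
    unfolding curvature_inf_def P_def[symmetric]
    by (rule Greatest_equality[of P, OF Sup upper])
  show "\<And>f. Gam2 G f f x \<ge> curvature_inf G x * Gam G f f x"
    using Sup by (simp add: eq P_def)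
  show "\<And>K. (\<And>f. Gam2 G f f x \<ge> K * Gam G f f x) \<Longrightarrow> K \<le> curvature_inf G x"
    using upper by (simp add: eq P_def)
qed

lemma curvature_inf_neg:
  assumes "neighbours G x \<noteq> {}" "Gam2 G f f x < 0"
  shows "curvature_inf G x < 0"
proof (rule ccontr)
  assume "\<not> curvature_inf G x < 0"
  moreover have "Gam G f f x \<ge> 0" by (simp add: Gam_eq sum_nonneg)
  ultimately have "curvature_inf G x * Gam G f f x \<ge> 0" by simp
  with curvature_inf_greatest(1)[OF assms(1), of f] assms(2) show False by linarith
qed

section \<open>Decomposition of the form and nonnegativity\<close>

text \<open>The second step of a walk returns to \<open>x\<close>, stays in the 1-sphere or enters
  the 2-sphere. The return contributes \<open>gamma2_kernel a 0 = 3 * a^2\<close>, which is the 3 in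
  the first coefficient.\<close>

lemma Gam2_split:
  assumes "x \<in> pverts G"
  shows "4 * Gam2 G f f x =
    (3 - real (degree G x)) * (\<Sum>y\<in>neighbours G x. (f y - f x)\<^sup>2)
    + 2 * (\<Sum>y\<in>neighbours G x. f y - f x)\<^sup>2
    + (\<Sum>y\<in>neighbours G x. \<Sum>z\<in>neighbours G y \<inter> neighbours G x.
        gamma2_kernel (f y - f x) (f z - f x))
    + (\<Sum>y\<in>neighbours G x. \<Sum>z\<in>neighbours G y \<inter> vsphere G 2 x.
        gamma2_kernel (f y - f x) (f z - f x))"
proof -
  let ?N = "neighbours G" and ?S = "vsphere G 2 x"
  have "(\<Sum>z\<in>?N y. gamma2_kernel (f y - f x) (f z - f x)) = 3 * (f y - f x)\<^sup>2
      + (\<Sum>z\<in>?N y \<inter> ?N x. gamma2_kernel (f y - f x) (f z - f x))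
      + (\<Sum>z\<in>?N y \<inter> ?S. gamma2_kernel (f y - f x) (f z - f x))" if y: "y \<in> ?N x" for y
  proof -
    have "?N y = insert x ((?N y \<inter> ?N x) \<union> (?N y \<inter> ?S))"
      using y neighbours_sym[of x y] by (auto simp: vsphere_2[OF assms])
    then have "(\<Sum>z\<in>?N y. gamma2_kernel (f y - f x) (f z - f x)) =
      (\<Sum>z\<in>insert x ((?N y \<inter> ?N x) \<union> (?N y \<inter> ?S)). gamma2_kernel (f y - f x) (f z - f x))"
      by (rule arg_cong)
    also have "\<dots> = gamma2_kernel (f y - f x) 0
      + (\<Sum>z\<in>(?N y \<inter> ?N x) \<union> (?N y \<inter> ?S). gamma2_kernel (f y - f x) (f z - f x))"
      using not_in_neighbours
      by (subst sum.insert) (auto simp: finite_neighbours vsphere_2[OF assms])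
    also have "(\<Sum>z\<in>(?N y \<inter> ?N x) \<union> (?N y \<inter> ?S). gamma2_kernel (f y - f x) (f z - f x)) =
      (\<Sum>z\<in>?N y \<inter> ?N x. gamma2_kernel (f y - f x) (f z - f x))
      + (\<Sum>z\<in>?N y \<inter> ?S. gamma2_kernel (f y - f x) (f z - f x))"
      by (rule sum.union_disjoint) (auto simp: finite_neighbours vsphere_2[OF assms])
    finally show ?thesis by (simp only: gamma2_kernel_0 add.assoc)
  qed
  then show ?thesis
    unfolding Gam2_eq by (simp add: sum.distrib sum_distrib_left[symmetric] algebra_simps)
qed

text \<open>A single orientation of an edge may contribute a negative amount, but the sum contains
  both, and \<open>gamma2_kernel a b + gamma2_kernel b a = 4 * (a - b)^2\<close>.\<close>

lemma triangle_sum_nonneg: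
  "0 \<le> (\<Sum>y\<in>neighbours G x. \<Sum>z\<in>neighbours G y \<inter> neighbours G x. gamma2_kernel (g y) (g z))"
proof -
  let ?N = "neighbours G"
  \<comment> \<open>Writing the intersection as an indicator makes the two index sets independent,
    so that the order of summation can be exchanged.\<close>
  have restrict: "(\<Sum>z\<in>?N y \<inter> ?N x. k z) = (\<Sum>z\<in>?N x. if z \<in> ?N y then k z else 0)"
    for k :: "'a \<Rightarrow> real" and y
    by (subst sum.inter_restrict[symmetric]) (auto simp: finite_neighbours Int_commute)
  have swap: "(\<Sum>y\<in>?N x. \<Sum>z\<in>?N y \<inter> ?N x. h y z) = (\<Sum>y\<in>?N x. \<Sum>z\<in>?N y \<inter> ?N x. h z y)"
    for h :: "'a \<Rightarrow> 'a \<Rightarrow> real"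
  proof -
    have "(\<Sum>y\<in>?N x. \<Sum>z\<in>?N y \<inter> ?N x. h y z) = (\<Sum>y\<in>?N x. \<Sum>z\<in>?N x. if z \<in> ?N y then h y z else 0)"
      by (simp only: restrict)
    also have "\<dots> = (\<Sum>z\<in>?N x. \<Sum>y\<in>?N x. if z \<in> ?N y then h y z else 0)"
      by (rule sum.swap)
    also have "\<dots> = (\<Sum>y\<in>?N x. \<Sum>z\<in>?N x. if z \<in> ?N y then h z y else 0)"
      by (intro sum.cong refl if_cong neighbours_sym)
    finally show ?thesis by (simp only: restrict)
  qed
  let ?k = "\<lambda>y z. gamma2_kernel (g y) (g z)"
  have "2 * (\<Sum>y\<in>?N x. \<Sum>z\<in>?N y \<inter> ?N x. ?k y z)
      = (\<Sum>y\<in>?N x. \<Sum>z\<in>?N y \<inter> ?N x. ?k y z) + (\<Sum>y\<in>?N x. \<Sum>z\<in>?N y \<inter> ?N x. ?k z y)"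
    using swap[of ?k] by simp
  also have "\<dots> = (\<Sum>y\<in>?N x. \<Sum>z\<in>?N y \<inter> ?N x. 4 * (g y - g z)\<^sup>2)"
    unfolding sum.distrib[symmetric]
    by (intro sum.cong refl) (simp only: gamma2_kernel_def power2_eq_square, simp add: algebra_simps)
  also have "\<dots> \<ge> 0" by (intro sum_nonneg) simp
  finally show ?thesis by simp
qed

lemma curvature_inf_nonneg:
  assumes "x \<in> pverts G" "neighbours G x \<noteq> {}"
    and le: "\<And>y. y \<in> neighbours G x \<Longrightarrow> degree G x + card (neighbours G y \<inter> vsphere G 2 x) \<le> 3"
  shows "curvature_inf G x \<ge> 0"
proof (rule curvature_inf_greatest(2)[OF assms(2)])
  fix f
  let ?N = "neighbours G" and ?S = "vsphere G 2 x"
  \<comment> \<open>Grouped by neighbour, the summand at \<open>y\<close> is at least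
    \<open>(f y - f x)^2\<close> times 3 minus the degree of \<open>x\<close> minus the number of
    neighbours of \<open>y\<close> in the 2-sphere.\<close>
  have "0 \<le> (\<Sum>y\<in>?N x. (3 - real (degree G x)) * (f y - f x)\<^sup>2
      + (\<Sum>z\<in>?N y \<inter> ?S. gamma2_kernel (f y - f x) (f z - f x)))"
  proof (rule sum_nonneg)
    fix y assume "y \<in> ?N x"
    from le[OF this] have "real (card (?N y \<inter> ?S)) \<le> 3 - real (degree G x)" by linarith
    then have "real (card (?N y \<inter> ?S)) * (f y - f x)\<^sup>2 \<le> (3 - real (degree G x)) * (f y - f x)\<^sup>2"
      by (rule mult_right_mono) simp
    moreover have "(\<Sum>z\<in>?N y \<inter> ?S. - (f y - f x)\<^sup>2) \<le>
        (\<Sum>z\<in>?N y \<inter> ?S. gamma2_kernel (f y - f x) (f z - f x))"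
      by (intro sum_mono gamma2_kernel_ge)
    ultimately show "0 \<le> (3 - real (degree G x)) * (f y - f x)\<^sup>2
      + (\<Sum>z\<in>?N y \<inter> ?S. gamma2_kernel (f y - f x) (f z - f x))" by simp
  qed
  then have "4 * Gam2 G f f x \<ge> 0"
    unfolding Gam2_split[OF assms(1)] sum.distrib sum_distrib_left[symmetric]
    using triangle_sum_nonneg[where g = "\<lambda>y. f y - f x" and x = x]
      zero_le_power2[of "\<Sum>y\<in>?N x. f y - f x"] by linarith
  then show "0 * Gam G f f x \<le> Gam2 G f f x" by simp
qed

lemma exceptional_ball2_curvature_nonneg:
  assumes x: "x \<in> pverts G" and ex: "exceptional_ball2 G x"
  shows "curvature_inf G x \<ge> 0"
proof (rule curvature_inf_nonneg[OF x])
  show "neighbours G x \<noteq> {}"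
    using ex by (auto simp: exceptional_ball2_def ball2_P3_def ball2_P4_def ball2_P5_def
        ball2_K13_def ball2_paw_def degree_eq_card)
  \<comment> \<open>Degree 2 leaves room for one neighbour of \<open>y\<close> in the 2-sphere,
    degree 3 for none.\<close>
  show "degree G x + card (neighbours G y \<inter> vsphere G 2 x) \<le> 3" if "y \<in> neighbours G x" for y
    using ex that unfolding exceptional_ball2_def ball2_P3_def ball2_P4_def ball2_P5_def
      ball2_K13_def ball2_paw_def vsphere_1[OF x, symmetric] by auto
qed

section \<open>Separated neighbours and two-valued test functions\<close>

text \<open>Every vertex of the 2-sphere keeps an arc to the 1-sphere after \<open>x\<close> is
  deleted, so it lies on the same side as some neighbour of \<open>x\<close>. Hence a separation of
  the punctured ball already separates the neighbours of \<open>x\<close>.\<close>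

lemma punctured_ball2_disconnectedE:
  assumes x: "x \<in> pverts G" and card: "card (pre_digraph.sccs (punctured_ball2 G x)) > 1"
  obtains C where "neighbours G x \<inter> C \<noteq> {}" "neighbours G x - C \<noteq> {}"
    "\<forall>y\<in>neighbours G x. \<forall>z\<in>neighbours G y \<inter> (neighbours G x \<union> vsphere G 2 x). y \<in> C \<longleftrightarrow> z \<in> C"
proof -
  let ?N = "neighbours G" and ?S = "vsphere G 2 x"
  let ?H = "punctured_ball2 G x"
  have verts: "verts ?H = ?N x \<union> ?S"
    using not_in_neighbours[of x]
    unfolding punctured_ball2_def ball2_def Let_def vsphere_1[OF x] vsphere_2[OF x]
    by (auto simp: pre_digraph.del_vert_def)
  have ends: "tail ?H = fst" "head ?H = snd"
    by (simp_all add: punctured_ball2_def pre_digraph.del_vert_def)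
  have arcs: "arcs ?H = parcs G \<inter> (?N x \<times> ?N x \<union> ?N x \<times> ?S \<union> ?S \<times> ?N x)"
    using not_in_neighbours[of x]
    unfolding punctured_ball2_def ball2_def Let_def vsphere_1[OF x] vsphere_2[OF x]
    by (auto simp: pre_digraph.del_vert_def)
  have arcs_ends: "arcs_ends ?H = arcs ?H"
    by (auto simp: arcs_ends_conv ends)
  interpret H: sym_digraph ?H
  proof
    show "symmetric ?H"
      unfolding symmetric_def arcs_ends by (auto simp: arcs intro!: symI arcs_symmetric)
  qed (auto simp: ends arcs verts)
  obtain C u v where C: "u \<in> verts ?H" "v \<in> verts ?H" "u \<in> C" "v \<notin> C"
    "\<And>p q. (p, q) \<in> arcs ?H \<Longrightarrow> p \<in> C \<longleftrightarrow> q \<in> C"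
    using H.sccs_disconnectedE[OF card] unfolding arcs_ends by metis
  have closed: "y \<in> C \<longleftrightarrow> z \<in> C"
    if "y \<in> ?N x" "z \<in> ?N y" "z \<in> ?N x \<union> ?S" for y z
    using that by (intro C(5)) (auto simp: arcs neighbours_def)
  have rep: "\<exists>y\<in>?N x. y \<in> C \<longleftrightarrow> w \<in> C" if "w \<in> verts ?H" for w
  proof (cases "w \<in> ?N x")
    case False
    with that have "w \<in> ?S" by (simp add: verts)
    then obtain y where "y \<in> ?N x" "w \<in> ?N y" by (auto simp: vsphere_2[OF x])
    with closed[of y w] \<open>w \<in> ?S\<close> show ?thesis by blast
  qed blast
  show ?thesis
  proof (rule that[of C])
    show "?N x \<inter> C \<noteq> {}" "?N x - C \<noteq> {}" using rep C by blast+
  qed (use closed in blast)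
qed

text \<open>
  The test function vanishes at \<open>x\<close>, is constant on each side of the partition of the
  neighbours, and is doubled on \<^term>\<open>vsphere G 2 x\<close>, where this minimises
  \<^const>\<open>gamma2_kernel\<close>.
\<close>
lemma Gam2_two_valued:
  assumes x: "x \<in> pverts G"
    and closed: "\<forall>y\<in>neighbours G x. \<forall>z\<in>neighbours G y \<inter> (neighbours G x \<union> vsphere G 2 x).
      y \<in> C \<longleftrightarrow> z \<in> C"
  defines "A \<equiv> neighbours G x \<inter> C" and "B \<equiv> neighbours G x - C"
  shows "\<exists>f. 4 * Gam2 G f f x =
      (3 - real (degree G x)) * (real (card A) * a\<^sup>2 + real (card B) * b\<^sup>2)
      + 2 * (real (card A) * a + real (card B) * b)\<^sup>2
      - real (\<Sum>y\<in>A. card (neighbours G y \<inter> vsphere G 2 x)) * a\<^sup>2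
      - real (\<Sum>y\<in>B. card (neighbours G y \<inter> vsphere G 2 x)) * b\<^sup>2"
proof -
  let ?N = "neighbours G" and ?S = "vsphere G 2 x"
  define c where "c v = (if v \<in> C then a else b)" for v
  define f where "f v = (if v = x then 0 else if v \<in> ?N x then c v else 2 * c v)" for v
  have split: "(\<Sum>y\<in>?N x. h y) = (\<Sum>y\<in>A. h y) + (\<Sum>y\<in>B. h y)" for h :: "'a \<Rightarrow> real"
    unfolding A_def B_def by (rule sum.Int_Diff) (rule finite_neighbours)
  have fx: "f x = 0" by (simp add: f_def)
  have fN: "f y = c y" if "y \<in> ?N x" for y
    using that not_in_neighbours by (auto simp: f_def)
  have fS: "f z = 2 * c z" if "z \<in> ?S" for z
    using that by (auto simp: f_def vsphere_2[OF x])
  have c_eq: "c z = c y" if "y \<in> ?N x" "z \<in> ?N y" "z \<in> ?N x \<union> ?S" for y z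
    using closed that by (simp add: c_def)
  have cA: "y \<in> A \<Longrightarrow> f y = a" and cB: "y \<in> B \<Longrightarrow> f y = b" for y
    using fN by (auto simp: A_def B_def c_def)
  \<comment> \<open>Adjacent neighbours of \<open>x\<close> lie on the same side, and
    \<open>gamma2_kernel a a = 0\<close>.\<close>
  have tri: "(\<Sum>y\<in>?N x. \<Sum>z\<in>?N y \<inter> ?N x. gamma2_kernel (f y) (f z)) = 0"
    by (intro sum.neutral ballI) (auto simp: fN c_eq gamma2_kernel_def)
  \<comment> \<open>At \<open>b = 2 * a\<close> the square in the kernel vanishes.\<close>
  have "(\<Sum>y\<in>?N x. \<Sum>z\<in>?N y \<inter> ?S. gamma2_kernel (f y) (f z)) =
      (\<Sum>y\<in>?N x. \<Sum>z\<in>?N y \<inter> ?S. - (f y)\<^sup>2)"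
    by (intro sum.cong refl) (auto simp: fN fS c_eq gamma2_kernel_def)
  also have "\<dots> = (\<Sum>y\<in>?N x. - real (card (?N y \<inter> ?S)) * (f y)\<^sup>2)" by simp
  also have "\<dots> = (\<Sum>y\<in>A. - real (card (?N y \<inter> ?S)) * a\<^sup>2)
      + (\<Sum>y\<in>B. - real (card (?N y \<inter> ?S)) * b\<^sup>2)"
    unfolding split by (simp add: cA cB)
  finally have sph: "(\<Sum>y\<in>?N x. \<Sum>z\<in>?N y \<inter> ?S. gamma2_kernel (f y) (f z)) =
      - real (\<Sum>y\<in>A. card (?N y \<inter> ?S)) * a\<^sup>2 - real (\<Sum>y\<in>B. card (?N y \<inter> ?S)) * b\<^sup>2"
    by (simp add: sum_distrib_right sum_negf)
  have "4 * Gam2 G f f x =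
      (3 - real (degree G x)) * (real (card A) * a\<^sup>2 + real (card B) * b\<^sup>2)
      + 2 * (real (card A) * a + real (card B) * b)\<^sup>2
      - real (\<Sum>y\<in>A. card (?N y \<inter> ?S)) * a\<^sup>2 - real (\<Sum>y\<in>B. card (?N y \<inter> ?S)) * b\<^sup>2"
    unfolding Gam2_split[OF x] fx diff_0_right tri sph split by (simp add: cA cB)
  then show ?thesis by blast
qed

section \<open>Negative curvature outside the exceptional balls\<close>

lemma disconnected_punctured_ball2_curvature_neg:
  assumes x: "x \<in> pverts G" and card: "card (pre_digraph.sccs (punctured_ball2 G x)) > 1"
    and nex: "\<not> exceptional_ball2 G x"
  shows "curvature_inf G x < 0"
proof -
  let ?N = "neighbours G" and ?S = "vsphere G 2 x"
  obtain C where C: "?N x \<inter> C \<noteq> {}" "?N x - C \<noteq> {}"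
    and closed: "\<forall>y\<in>?N x. \<forall>z\<in>?N y \<inter> (?N x \<union> ?S). y \<in> C \<longleftrightarrow> z \<in> C"
    by (rule punctured_ball2_disconnectedE[OF x card])
  define A where "A = ?N x \<inter> C"
  define B where "B = ?N x - C"
  define s where "s y = card (?N y \<inter> ?S)" for y
  have fin: "finite A" "finite B" by (simp_all add: A_def B_def finite_neighbours)
  have AB: "?N x = A \<union> B" "A \<inter> B = {}" by (auto simp: A_def B_def)
  have pos: "card A > 0" "card B > 0" using C fin by (auto simp: A_def B_def card_gt_0_iff)
  have deg: "degree G x = card A + card B"
    unfolding degree_eq_card AB(1) by (rule card_Un_disjoint[OF fin AB(2)])
  have neg: "curvature_inf G x < 0"
    if less: "(3 - real (degree G x)) * (real (card A) * a\<^sup>2 + real (card B) * b\<^sup>2)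
      + 2 * (real (card A) * a + real (card B) * b)\<^sup>2
      - real (sum s A) * a\<^sup>2 - real (sum s B) * b\<^sup>2 < 0" for a b
  proof -
    have "\<exists>f. 4 * Gam2 G f f x < 0"
      using Gam2_two_valued[OF x closed, of a b] less
      unfolding A_def B_def s_def by (elim exE) (rule exI, erule ord_eq_less_trans)
    then obtain f where "Gam2 G f f x < 0" by auto
    with C show ?thesis by (intro curvature_inf_neg[of x f]) auto
  qed
  have no_arc: "z \<notin> ?N y" if "y \<in> A" "z \<in> B" for y z
    using that closed by (auto simp: A_def B_def)
  have S_empty: "?S = {}" if "\<And>y. y \<in> ?N x \<Longrightarrow> s y = 0"
    using that by (fastforce simp: s_def vsphere_2[OF x] finite_neighbours)
  \<comment> \<open>Both sides of the partition are nonempty, so the degree is at least 2.\<close>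
  consider "degree G x \<ge> 4" | "degree G x = 3" | "degree G x = 2"
    using deg pos by linarith
  then show ?thesis
  proof cases
    case 1
    \<comment> \<open>The weights \<open>card B\<close> and \<open>- card A\<close> make the test
      function sum to zero over the neighbours, so the squared sum drops out and the negative factor
      \<open>3 - degree G x\<close> decides.\<close>
    have "(3 - real (degree G x)) *
        (real (card A) * (real (card B))\<^sup>2 + real (card B) * (- real (card A))\<^sup>2) < 0"
      using 1 pos by (intro mult_neg_pos add_pos_pos) auto
    moreover have "real (sum s A) * (real (card B))\<^sup>2 \<ge> 0"
      "real (sum s B) * (- real (card A))\<^sup>2 \<ge> 0" by (simp_all add: sum_nonneg)
    ultimately show ?thesis
      by (intro neg[of "real (card B)" "- real (card A)"])
        (simp add: mult.commute[of "real (card B)" "real (card A)"])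
  next
    case 2
    show ?thesis
    \<comment> \<open>Now \<open>3 - degree G x\<close> is zero, and the same weights leave only the
      terms of the edges into the 2-sphere.\<close>
    proof (cases "sum s A = 0 \<and> sum s B = 0")
      case False
      then have "real (sum s A) * (real (card B))\<^sup>2 + real (sum s B) * (- real (card A))\<^sup>2 > 0"
        using pos by (cases "sum s A = 0") (auto intro!: add_pos_nonneg simp del: of_nat_sum)
      with 2 show ?thesis
        by (intro neg[of "real (card B)" "- real (card A)"])
          (simp add: mult.commute[of "real (card B)" "real (card A)"])
    next
      case True
      then have "?S = {}" using S_empty fin AB(1) by auto
      moreover have "\<not> (adjacent_pairs G x = {} \<or> card (adjacent_pairs G x) = 1)"
        using nex 2 \<open>?S = {}\<close> by (auto simp: exceptional_ball2_def ball2_K13_def ball2_paw_def)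
      \<comment> \<open>One side is a single vertex with no adjacent neighbour of \<open>x\<close>,
        so at most the two vertices of the other side are adjacent. This leaves only the star and
        the triangle with a pendant edge, both excluded.\<close>
      moreover have "\<exists>p q. adjacent_pairs G x \<subseteq> {{p, q}}"
      proof -
        from 2 deg pos consider "card A = 1" "card B = 2" | "card A = 2" "card B = 1" by linarith
        then obtain r p q where N: "?N x = {r, p, q}" and "p \<notin> ?N r" "q \<notin> ?N r"
        proof cases
          case 1
          then obtain r p q where "A = {r}" "B = {p, q}" by (auto simp: card_1_singleton_iff card_2_iff)
          with no_arc[of r p] no_arc[of r q] AB(1) show ?thesis by (intro that[of r p q]) auto
        next
          case 2
          then obtain r p q where "B = {r}" "A = {p, q}" by (auto simp: card_1_singleton_iff card_2_iff)
          with no_arc[of p r] no_arc[of q r] AB(1) show ?thesis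
            using neighbours_sym[of p r] neighbours_sym[of q r] by (intro that[of r p q]) auto
        qed
        then have "adjacent_pairs G x \<subseteq> {{p, q}}"
          using not_in_neighbours[of r] not_in_neighbours[of p] not_in_neighbours[of q]
            neighbours_sym[of p r] neighbours_sym[of q r]
          unfolding adjacent_pairs_def vsphere_1[OF x] N by (auto simp: neighbours_def)
        then show ?thesis by blast
      qed
      ultimately show ?thesis
        by (elim exE) (drule subset_singletonD, auto)
    qed
  next
    case 3
    with deg pos have one: "card A = 1" "card B = 1" by linarith+
    then obtain p q where pq: "A = {p}" "B = {q}" by (auto simp: card_1_singleton_iff)
    have "p \<noteq> q" using pq AB(2) by auto
    have N: "vsphere G 1 x = {p, q}" unfolding vsphere_1[OF x] AB(1) pq by blast
    have adj: "adjacent_pairs G x = {}"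
    proof -
      have "q \<notin> ?N p" using no_arc pq by blast
      moreover from this have "p \<notin> ?N q" using neighbours_sym by blast
      ultimately show ?thesis
        using not_in_neighbours[of p] not_in_neighbours[of q]
        unfolding adjacent_pairs_def N by (auto simp: neighbours_def)
    qed
    consider "s p \<ge> 2" | "s q \<ge> 2" | "s p = 0" "s q = 0" | "s p = 1" "s q = 0"
      | "s p = 0" "s q = 1" | "s p = 1" "s q = 1" by linarith
    then show ?thesis
    proof cases
      case 1
      \<comment> \<open>The value \<open>- 2 / 3\<close> minimises
        \<open>1 + b^2 + 2 * (1 + b)^2\<close>. The minimum is 5/3, below the amount
        \<open>s p\<close>, at least 2, that is subtracted; the zero-sum choice
        \<open>b = - 1\<close> would give only zero for \<open>s p = 2\<close> and
        \<open>s q = 0\<close>.\<close>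
      have "real (s q) * (- 2 / 3)\<^sup>2 \<ge> 0" by simp
      with 1 3 one pq show ?thesis
        by (intro neg[of 1 "- 2 / 3"]) (simp add: power2_eq_square)
    next
      case 2
      have "real (s p) * (- 2 / 3)\<^sup>2 \<ge> 0" by simp
      with 2 3 one pq show ?thesis
        by (intro neg[of "- 2 / 3" 1]) (simp add: power2_eq_square)
    next
      case 3
      then have "?S = {}" using AB(1) pq by (intro S_empty) auto
      with adj \<open>degree G x = 2\<close> nex show ?thesis
        by (simp add: exceptional_ball2_def ball2_P3_def)
    next
      case 4
      then have "?N q \<inter> ?S = {}" by (simp add: s_def finite_neighbours)
      then have "ball2_P4 G x"
        unfolding ball2_P4_def using 4 adj \<open>degree G x = 2\<close> N \<open>p \<noteq> q\<close>
        by (intro conjI exI[of _ q] exI[of _ p]) (auto simp: s_def)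
      with nex show ?thesis by (simp add: exceptional_ball2_def)
    next
      case 5
      then have "?N p \<inter> ?S = {}" by (simp add: s_def finite_neighbours)
      then have "ball2_P4 G x"
        unfolding ball2_P4_def using 5 adj \<open>degree G x = 2\<close> N \<open>p \<noteq> q\<close>
        by (intro conjI exI[of _ p] exI[of _ q]) (auto simp: s_def)
      with nex show ?thesis by (simp add: exceptional_ball2_def)
    next
      case 6
      then obtain u v where uv: "?N p \<inter> ?S = {u}" "?N q \<inter> ?S = {v}"
        by (auto simp: s_def card_1_singleton_iff)
      \<comment> \<open>Separation keeps the two outer vertices on different sides, which rules out
        a 4-cycle through \<open>x\<close> and leaves the path with five vertices.\<close>
      have "u \<in> C" "v \<notin> C"
        using closed uv pq unfolding A_def B_def by blast+
      then have "u \<noteq> v" by blast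
      with uv adj \<open>degree G x = 2\<close> N \<open>p \<noteq> q\<close> have "ball2_P5 G x"
        unfolding ball2_P5_def by blast
      with nex show ?thesis by (simp add: exceptional_ball2_def)
    qed
  qed
qed

end

theorem theorem6p4:
  fixes G :: "'a pair_pre_digraph" and x :: 'a
  assumes "locally_finite_graph G"
    and "x \<in> pverts G"
  shows "(card (pre_digraph.sccs (punctured_ball2 G x)) > 1 \<and> \<not> exceptional_ball2 G x
            \<longrightarrow> curvature_inf G x < 0) \<and>
         (exceptional_ball2 G x \<longrightarrow> curvature_inf G x \<ge> 0)"
proof -
  interpret locally_finite_graph G by fact
  show ?thesis
    using disconnected_punctured_ball2_curvature_neg exceptional_ball2_curvature_nonneg assms(2)
    by blast
qed

end
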